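(* Let $(S,E)$ be a Weyl $*$-semigroup. The set $\mathcal{C}(S)$ of non-empty cosets in $S$ forms a groupoid under the inverse and product \[C\mapsto C^*\qquad\text{and}\qquad(B,C)\mapsto(BC)^{\precsim},\] where the product is defined whenever $(B^*B)^{\precsim}=(CC^* )^{\precsim}$, in which case $(BC)^{\precsim}=(Bc)^{\precsim}$ for any $c\in C$.
   Context: A $*$-semigroup is a semigroup $S$ with a unary operation $a\mapsto a^*$ satisfying $a^{**}=a$ and $(ab)^*=b^*a^*$. For $T,U\subseteq S$ and $c\in S$: $TU=\{tu:t\in T,u\in U\}$, $Tc=\{tc:t\in T\}$, $T^*=\{t^*:t\in T\}$. A Weyl $*$-semigroup $(S,E)$ is a $*$-semigroup $S$ with a subset $E$ such that $EE\subseteq E=E^*$, $a^*Ea\subseteq E$ for all $a\in S$, and for every $a\in S$ the element $a^*a$ lies in $E$ and commutes with every element of $E$. For $a,b\in S$: $a\precsim b$ iff $ab^*\in E$ and $a=ab^*b$. For $T\subseteq S$, $T^{\precsim}=\{a\in S:\exists t\in T\ (t\precsim a)\}$. A coset is a subset $C\subseteq S$ with $CC^*C\subseteq C=C^{\precsim}$. *)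

theory Defs
  imports Main "HOL-Library.Set_Algebras"
begin

text \<open>Products of subsets are those of \<^theory>\<open>HOL-Library.Set_Algebras\<close>:
  \<open>T * U = {t * u | t u. t \<in> T \<and> u \<in> U}\<close>. The image \<open>star ` T\<close> is $T^*$.\<close>

class star_semigroup = semigroup_mult +
  fixes star :: "'a \<Rightarrow> 'a"
  assumes star_star: "star (star a) = a"
    and star_mult: "star (a * b) = star b * star a"

definition weyl_star_semigroup :: "'a::star_semigroup set \<Rightarrow> bool" where
  "weyl_star_semigroup E \<longleftrightarrow>
     E * E \<subseteq> E \<and> E = star ` E \<and>
     (\<forall>a. {star a} * E * {a} \<subseteq> E) \<and>
     (\<forall>a. star a * a \<in> E \<and> (\<forall>e\<in>E. (star a * a) * e = e * (star a * a)))"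

definition below :: "'a::star_semigroup set \<Rightarrow> 'a \<Rightarrow> 'a \<Rightarrow> bool" where
  "below E a b \<longleftrightarrow> a * star b \<in> E \<and> a = a * star b * b"

definition up_closure :: "'a::star_semigroup set \<Rightarrow> 'a set \<Rightarrow> 'a set" where
  "up_closure E T = {a. \<exists>t\<in>T. below E t a}"

text \<open>The relation \<^const>\<open>below\<close> is not reflexive in general, so \<open>C = up_closure E C\<close>
  demands more than upward closedness.\<close>

definition coset :: "'a::star_semigroup set \<Rightarrow> 'a set \<Rightarrow> bool" where
  "coset E C \<longleftrightarrow> C * star ` C * C \<subseteq> C \<and> C = up_closure E C"

definition nonempty_cosets :: "'a::star_semigroup set \<Rightarrow> 'a set set" where
  "nonempty_cosets E = {C. coset E C \<and> C \<noteq> {}}"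

text \<open>A groupoid is a small category all of whose arrows are invertible. Categories are
  given in the arrows-only form (Mac Lane, Categories for the Working Mathematician, I.1):
  \<open>G\<close> is the set of arrows, \<open>D\<close> the set of composable pairs and \<open>m\<close> the
  composition, which is only meaningful on \<open>D\<close>. The objects are the identity arrows.\<close>

definition identity_arrow :: "'g set \<Rightarrow> ('g \<times> 'g) set \<Rightarrow> ('g \<Rightarrow> 'g \<Rightarrow> 'g) \<Rightarrow> 'g \<Rightarrow> bool" where
  "identity_arrow G D m u \<longleftrightarrow>
     u \<in> G \<and> (\<forall>x. (u, x) \<in> D \<longrightarrow> m u x = x) \<and> (\<forall>x. (x, u) \<in> D \<longrightarrow> m x u = x)"

definition small_category :: "'g set \<Rightarrow> ('g \<times> 'g) set \<Rightarrow> ('g \<Rightarrow> 'g \<Rightarrow> 'g) \<Rightarrow> bool" where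
  "small_category G D m \<longleftrightarrow>
     D \<subseteq> G \<times> G \<and>
     (\<forall>x y. (x, y) \<in> D \<longrightarrow> m x y \<in> G) \<and>
     (\<forall>x\<in>G. \<forall>y\<in>G. \<forall>z\<in>G.
        ((x, y) \<in> D \<and> (m x y, z) \<in> D \<longleftrightarrow> (y, z) \<in> D \<and> (x, m y z) \<in> D) \<and>
        ((x, y) \<in> D \<and> (m x y, z) \<in> D \<longrightarrow> m (m x y) z = m x (m y z)) \<and>
        ((x, y) \<in> D \<and> (y, z) \<in> D \<longrightarrow> (m x y, z) \<in> D)) \<and>
     (\<forall>x\<in>G. \<exists>u v. identity_arrow G D m u \<and> identity_arrow G D m v \<and>
        (u, x) \<in> D \<and> (x, v) \<in> D)"

definition groupoid ::
    "'g set \<Rightarrow> ('g \<times> 'g) set \<Rightarrow> ('g \<Rightarrow> 'g \<Rightarrow> 'g) \<Rightarrow> ('g \<Rightarrow> 'g) \<Rightarrow> bool" where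
  "groupoid G D m i \<longleftrightarrow>
     small_category G D m \<and>
     (\<forall>x\<in>G. i x \<in> G \<and>
        (i x, x) \<in> D \<and> identity_arrow G D m (m (i x) x) \<and>
        (x, i x) \<in> D \<and> identity_arrow G D m (m x (i x)))"

definition composable_cosets :: "'a::star_semigroup set \<Rightarrow> ('a set \<times> 'a set) set" where
  "composable_cosets E =
     {(B, C). B \<in> nonempty_cosets E \<and> C \<in> nonempty_cosets E \<and>
        up_closure E (star ` B * B) = up_closure E (C * star ` C)}"

end

theory Submission
  imports Defs
begin

text \<open>
  The proof is arithmetic with subsets of the semigroup. The relation \<open>\<lesssim>\<close> is transitive
  and respects product and involution, hence \<open>\<up>T * \<up>U \<subseteq> \<up>(T * U)\<close>. The relation need not
  be reflexive, so \<open>T \<subseteq> \<up>T\<close> can fail; but it holds for cosets and passes to products and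
  adjoints. For such sets a closure around a factor can be dropped inside an outer closure, and
  cosets multiply as if \<open>\<up>\<close> were an ordinary closure operator.

  What makes the structure a groupoid is \<open>below_mult_right\<close>: multiplying the
  smaller side of \<open>x \<lesssim> y\<close> by an element of \<open>E\<close> keeps it below \<open>y\<close>. Hence \<open>T \<subseteq> \<up>T\<close> implies
  \<open>T \<subseteq> \<up>(T * {e})\<close> for each \<open>e \<in> E\<close>, and factors such as \<open>star a * a\<close> can be inserted into a
  product of such sets, up to closure. With \<open>e = star c * c\<close> for \<open>c \<in> C\<close> this gives \<open>B * C \<subseteq> \<up>(B * {c})\<close>, since
  \<open>B * (C * star ` C) \<subseteq> B\<close> for composable cosets (\<open>composable_absorb\<close>). In the same way it gives
  \<open>C = \<up>(C * star ` C * C)\<close>, and it shows that a product \<open>\<up>(B * C)\<close> has the source \<open>\<up>(star ` C * C)\<close>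
  of its second factor and the target \<open>\<up>(B * star ` B)\<close> of its first. Composability is therefore
  the matching of sources and targets; the groupoid laws follow.
\<close>

section \<open>The relation and its up-closure\<close>

locale weyl_star =
  fixes E :: "'a::star_semigroup set"
  assumes weyl: "weyl_star_semigroup E"
begin

abbreviation less_sim :: "'a \<Rightarrow> 'a \<Rightarrow> bool" (infix "\<lesssim>" 50) where
  "a \<lesssim> b \<equiv> below E a b"

abbreviation up :: "'a set \<Rightarrow> 'a set" ("\<up>_" [90] 90) where
  "\<up>T \<equiv> up_closure E T"

lemma E_mult: "e \<in> E \<Longrightarrow> f \<in> E \<Longrightarrow> e * f \<in> E"
  using weyl unfolding weyl_star_semigroup_def by (blast intro: set_times_intro)

lemma E_star: "e \<in> E \<Longrightarrow> star e \<in> E"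
  using weyl unfolding weyl_star_semigroup_def by blast

lemma E_conj: "e \<in> E \<Longrightarrow> star a * e * a \<in> E"
  using weyl unfolding weyl_star_semigroup_def by (blast intro: set_times_intro)

lemma E_conj': "e \<in> E \<Longrightarrow> a * e * star a \<in> E"
  using E_conj[of e "star a"] by (simp add: star_star)

lemma E_square: "star a * a \<in> E"
  using weyl unfolding weyl_star_semigroup_def by blast

lemma E_commute: "e \<in> E \<Longrightarrow> star a * a * e = e * (star a * a)"
  using weyl unfolding weyl_star_semigroup_def by blast

lemma E_commute': "e \<in> E \<Longrightarrow> a * star a * e = e * (a * star a)"
  using E_commute[of e "star a"] by (simp add: star_star)

lemma below_trans:
  assumes "a \<lesssim> b" "b \<lesssim> c"
  shows "a \<lesssim> c"
proof -
  have ab: "a * star b \<in> E" "a = a * star b * b" and bc: "b * star c \<in> E" "b = b * star c * c"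
    using assms by (auto simp: below_def)
  have "a * star c = (a * star b) * (b * star c)"
    using ab(2) by (metis mult.assoc)
  moreover have "a * star c * c = a"
    using ab(2) bc(2) by (metis mult.assoc)
  ultimately show ?thesis
    using E_mult[OF ab(1) bc(1)] by (simp add: below_def)
qed

text \<open>Here \<open>a * c * star (b * d)\<close> equals \<open>(a * star b) * (b * (c * star d) * star b)\<close>, with a
  conjugate of an element of \<open>E\<close> as second factor; the equation follows by moving \<open>star b * b\<close>
  past \<open>c * star d\<close>.\<close>

lemma below_mult:
  assumes "a \<lesssim> b" "c \<lesssim> d"
  shows "a * c \<lesssim> b * d"
proof -
  have ab: "a * star b \<in> E" "a = a * star b * b" and cd: "c * star d \<in> E" "c = c * star d * d"
    using assms by (auto simp: below_def)
  have "a * c * star (b * d) = (a * star b) * (b * (c * star d) * star b)"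
    using ab(2) by (metis mult.assoc star_mult)
  then have "a * c * star (b * d) \<in> E"
    using E_mult[OF ab(1) E_conj'[OF cd(1)]] by simp
  moreover have "a * c * star (b * d) * (b * d) = a * c"
  proof -
    have "a * c * star (b * d) * (b * d) = a * ((c * star d) * (star b * b)) * d"
      by (simp add: star_mult mult.assoc)
    also have "\<dots> = a * (star b * b * (c * star d)) * d"
      by (simp add: E_commute[OF cd(1)])
    also have "\<dots> = (a * star b * b) * (c * star d * d)"
      by (simp add: mult.assoc)
    finally show ?thesis
      using ab(2) cd(2) by simp
  qed
  ultimately show ?thesis
    by (simp add: below_def)
qed

text \<open>Substituting \<open>star a = star b * (b * star a)\<close> makes \<open>star a * b\<close> a conjugate of an element
  of \<open>E\<close> and lets \<open>b * star b\<close> move past \<open>b * star a\<close>.\<close>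

lemma below_star:
  assumes "a \<lesssim> b"
  shows "star a \<lesssim> star b"
proof -
  have ab: "a * star b \<in> E" "a = a * star b * b"
    using assms by (auto simp: below_def)
  have E: "b * star a \<in> E"
    using E_star[OF ab(1)] by (simp add: star_mult star_star)
  have sa: "star a = star b * (b * star a)"
    using arg_cong[OF ab(2), of star] by (simp add: star_mult star_star)
  have "star a * b = star b * (b * star a) * b"
    using sa by simp
  then have "star a * b \<in> E"
    using E_conj[OF E, of b] by simp
  moreover have "star a * b * star b = star a"
  proof -
    have "star a * b * star b = star b * ((b * star a) * (b * star b))"
      using sa by (metis mult.assoc)
    also have "\<dots> = star b * (b * star b * (b * star a))"
      by (simp add: E_commute'[OF E])
    also have "\<dots> = star b * (b * (star b * (b * star a)))"
      by (simp add: mult.assoc)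
    finally show ?thesis
      using sa by simp
  qed
  ultimately show ?thesis
    by (simp add: below_def star_star)
qed

text \<open>Writing \<open>x = x * star y * y\<close> turns \<open>x * e * star y\<close> into the product of \<open>x * star y\<close> and
  a conjugate of \<open>e\<close>; the second condition holds because \<open>e\<close> commutes with \<open>star y * y\<close>.\<close>

lemma below_mult_right:
  assumes "x \<lesssim> y" "e \<in> E"
  shows "x * e \<lesssim> y"
proof -
  have xy: "x * star y \<in> E" "x = x * star y * y"
    using assms(1) by (auto simp: below_def)
  have "x * e * star y = (x * star y) * (y * e * star y)"
    using xy(2) by (metis mult.assoc)
  then have "x * e * star y \<in> E"
    using E_mult[OF xy(1) E_conj'[OF assms(2)]] by simp
  moreover have "x * e * star y * y = x * e"
  proof -
    have "x * e * star y * y = x * (e * (star y * y))"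
      by (simp add: mult.assoc)
    also have "\<dots> = x * (star y * y * e)"
      by (simp add: E_commute[OF assms(2)])
    also have "\<dots> = x * star y * y * e"
      by (simp add: mult.assoc)
    finally show ?thesis
      using xy(2) by simp
  qed
  ultimately show ?thesis
    by (simp add: below_def)
qed

lemma up_mono: "T \<subseteq> U \<Longrightarrow> \<up>T \<subseteq> \<up>U"
  by (auto simp: up_closure_def)

lemma up_up: "\<up>(\<up>T) \<subseteq> \<up>T"
  by (auto simp: up_closure_def intro: below_trans)

lemma up_least: "T \<subseteq> \<up>U \<Longrightarrow> \<up>T \<subseteq> \<up>U"
  using up_mono up_up by blast

lemma up_idem: "T \<subseteq> \<up>T \<Longrightarrow> \<up>(\<up>T) = \<up>T"
  by (meson subset_antisym up_mono up_up)

lemma up_times: "\<up>T * \<up>U \<subseteq> \<up>(T * U)"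
  unfolding up_closure_def by (fastforce elim!: set_times_elim intro: below_mult)

lemma times_subset_up: "T \<subseteq> \<up>T' \<Longrightarrow> U \<subseteq> \<up>U' \<Longrightarrow> T * U \<subseteq> \<up>(T' * U')"
  by (meson order_trans set_times_mono2 up_times)

lemma star_image_star: "star ` star ` T = (T :: 'a set)"
  by (simp add: image_image star_star)

lemma star_image_times: "star ` (T * U) = star ` U * star ` (T :: 'a set)"
  by (auto simp: star_mult set_times_def image_iff) (metis star_mult)+

lemma star_up_subset: "star ` \<up>T \<subseteq> \<up>(star ` T)"
  by (auto simp: up_closure_def intro: below_star)

lemma star_up: "star ` \<up>T = \<up>(star ` T)"
proof
  have "star ` \<up>(star ` T) \<subseteq> \<up>T"
    using star_up_subset[of "star ` T"] by (simp add: star_image_star)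
  then show "\<up>(star ` T) \<subseteq> star ` \<up>T"
    using image_mono star_image_star by metis
qed (rule star_up_subset)

lemma up_up_times:
  assumes "T \<subseteq> \<up>T" "U \<subseteq> \<up>U"
  shows "\<up>(\<up>T * U) = \<up>(T * U)"
  by (intro subset_antisym up_least up_mono set_times_mono2 times_subset_up assms order_refl)

lemma up_times_up:
  assumes "T \<subseteq> \<up>T" "U \<subseteq> \<up>U"
  shows "\<up>(T * \<up>U) = \<up>(T * U)"
  by (intro subset_antisym up_least up_mono set_times_mono2 times_subset_up assms order_refl)

lemma subset_up_times_E:
  assumes "T \<subseteq> \<up>T" "e \<in> E"
  shows "T \<subseteq> \<up>(T * {e})"
proof
  fix y assume "y \<in> T"
  then obtain x where "x \<in> T" "x \<lesssim> y"
    using assms(1) by (auto simp: up_closure_def)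
  then show "y \<in> \<up>(T * {e})"
    using below_mult_right[OF _ assms(2)] by (auto simp: up_closure_def)
qed

section \<open>Cosets, their sources and their targets\<close>

abbreviation source :: "'a set \<Rightarrow> 'a set" where
  "source C \<equiv> \<up>(star ` C * C)"

abbreviation target :: "'a set \<Rightarrow> 'a set" where
  "target C \<equiv> \<up>(C * star ` C)"

abbreviation cosets :: "'a set set" where
  "cosets \<equiv> nonempty_cosets E"

lemma cosets_nonempty: "C \<in> cosets \<Longrightarrow> C \<noteq> {}"
  by (simp add: nonempty_cosets_def)

lemma cosets_triple: "C \<in> cosets \<Longrightarrow> C * star ` C * C \<subseteq> C"
  by (simp add: nonempty_cosets_def coset_def)

lemma cosets_up: "C \<in> cosets \<Longrightarrow> \<up>C = C"
  by (simp add: nonempty_cosets_def coset_def)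

lemma star_cosets:
  assumes "C \<in> cosets"
  shows "star ` C \<in> cosets"
proof -
  have "star ` C * star ` star ` C * star ` C = star ` (C * star ` C * C)"
    by (simp add: star_image_times mult.assoc)
  moreover have "\<up>(star ` C) = star ` C"
    using cosets_up[OF assms] by (simp flip: star_up)
  ultimately show ?thesis
    using cosets_triple[OF assms] cosets_nonempty[OF assms]
    by (auto simp: nonempty_cosets_def coset_def)
qed

lemma composite_subset_up:
  assumes "B \<in> cosets" "C \<in> cosets"
  shows "B * C \<subseteq> \<up>(B * C)"
  by (rule times_subset_up) (simp_all add: cosets_up assms)

text \<open>Cosets are closed under \<open>\<up>\<close>, so \<open>B * star ` B * B \<subseteq> B\<close> improves to \<open>B * source B \<subseteq> B\<close>;
  composability puts \<open>C * star ` C\<close> into the source of \<open>B\<close>.\<close>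

lemma composable_absorb:
  assumes B: "B \<in> cosets" and C: "C \<in> cosets" and BC: "source B = target C"
  shows "B * (C * star ` C) \<subseteq> B"
proof -
  have "C * star ` C \<subseteq> source B"
    unfolding BC by (intro composite_subset_up star_cosets C)
  with eq_refl[OF cosets_up[OF B, symmetric]]
  have "B * (C * star ` C) \<subseteq> \<up>(B * (star ` B * B))"
    by (rule times_subset_up)
  also have "\<dots> \<subseteq> \<up>B"
    using up_mono[OF cosets_triple[OF B]] by (simp add: mult.assoc)
  finally show ?thesis
    by (simp add: cosets_up B)
qed

lemma composite_triple:
  assumes B: "B \<in> cosets" and C: "C \<in> cosets" and BC: "source B = target C"
  shows "(B * C) * star ` (B * C) * (B * C) \<subseteq> B * C"
proof -
  have "(B * C) * star ` (B * C) * (B * C) = B * (C * star ` C) * (star ` B * B * C)"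
    by (simp add: star_image_times mult.assoc)
  also have "\<dots> \<subseteq> B * (star ` B * B * C)"
    by (intro set_times_mono2 composable_absorb assms order_refl)
  also have "\<dots> = B * star ` B * B * C"
    by (simp add: mult.assoc)
  also have "\<dots> \<subseteq> B * C"
    by (intro set_times_mono2 cosets_triple B order_refl)
  finally show ?thesis .
qed

lemma composite_cosets:
  assumes B: "B \<in> cosets" and C: "C \<in> cosets" and BC: "source B = target C"
  shows "\<up>(B * C) \<in> cosets"
proof -
  let ?T = "B * C"
  have sub: "?T \<subseteq> \<up>?T"
    by (rule composite_subset_up[OF B C])
  have "\<up>?T * star ` \<up>?T * \<up>?T \<subseteq> \<up>(?T * star ` ?T * ?T)"
    unfolding star_up by (intro times_subset_up order_refl)
  also have "\<dots> \<subseteq> \<up>?T"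
    by (rule up_mono[OF composite_triple[OF assms]])
  finally have "\<up>?T * star ` \<up>?T * \<up>?T \<subseteq> \<up>?T" .
  moreover have "\<up>?T \<noteq> {}"
    using sub cosets_nonempty[OF B] cosets_nonempty[OF C] by (force simp: set_times_def)
  ultimately show ?thesis
    using up_idem[OF sub] by (simp add: nonempty_cosets_def coset_def)
qed

text \<open>Since \<open>star c * c \<in> E\<close> can be appended to \<open>B * C\<close>, the product
  shrinks to \<open>B * {c}\<close> because \<open>B\<close> absorbs \<open>C * {star c}\<close>.\<close>

lemma composite_single:
  assumes B: "B \<in> cosets" and C: "C \<in> cosets" and BC: "source B = target C" and c: "c \<in> C"
  shows "\<up>(B * C) = \<up>(B * {c})"
proof
  have "B * C \<subseteq> \<up>(B * C * {star c * c})"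
    by (intro subset_up_times_E E_square composite_subset_up B C)
  also have "\<dots> \<subseteq> \<up>(B * {c})"
  proof (rule up_mono)
    have "{star c * c} = {star c} * {c}"
      by (simp add: set_times_def)
    then have "B * C * {star c * c} = B * (C * {star c}) * {c}"
      by (simp only: mult.assoc)
    also have "\<dots> \<subseteq> B * (C * star ` C) * {c}"
      using c by (intro set_times_mono2) auto
    also have "\<dots> \<subseteq> B * {c}"
      by (intro set_times_mono2 composable_absorb B C BC order_refl)
    finally show "B * C * {star c * c} \<subseteq> B * {c}" .
  qed
  finally show "\<up>(B * C) \<subseteq> \<up>(B * {c})"
    by (rule up_least)
  show "\<up>(B * {c}) \<subseteq> \<up>(B * C)"
    using c by (intro up_mono set_times_mono2) auto
qed

text \<open>The source of \<open>\<up>(B * C)\<close> is the closure of \<open>star ` C * (star ` B * B) * C\<close>.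
  For \<open>\<subseteq>\<close>, the inner \<open>star ` B * B\<close> is absorbed by \<open>star ` C\<close>, as \<open>star ` C\<close> and \<open>star ` B\<close>
  are composable too.
  For \<open>\<supseteq>\<close>, a single \<open>star b * b \<in> E\<close> can be inserted between \<open>star ` C\<close> and \<open>C\<close>.\<close>

lemma source_composite:
  assumes B: "B \<in> cosets" and C: "C \<in> cosets" and BC: "source B = target C"
  shows "source (\<up>(B * C)) = source C"
proof -
  have sub: "B * C \<subseteq> \<up>(B * C)"
    by (rule composite_subset_up[OF B C])
  have star_sub: "star ` (B * C) \<subseteq> \<up>(star ` (B * C))"
    using sub by (simp add: image_mono flip: star_up)
  have "source (\<up>(B * C)) = \<up>(star ` (B * C) * \<up>(B * C))"
    unfolding star_up by (rule up_up_times[OF star_sub]) (simp add: up_idem sub)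
  also have "\<dots> = \<up>(star ` C * (star ` B * B) * C)"
    using up_times_up[OF star_sub sub] by (simp add: star_image_times mult.assoc)
  also have "\<dots> = source C"
  proof
    have "star ` C * (star ` B * star ` star ` B) \<subseteq> star ` C"
      using BC by (intro composable_absorb star_cosets B C) (simp add: star_image_star)
    then have "star ` C * (star ` B * B) * C \<subseteq> star ` C * C"
      by (intro set_times_mono2) (simp_all add: star_image_star)
    then show "\<up>(star ` C * (star ` B * B) * C) \<subseteq> source C"
      by (rule up_mono)
  next
    obtain b where b: "b \<in> B"
      using cosets_nonempty[OF B] by blast
    have "star ` C \<subseteq> \<up>(star ` C * {star b * b})"
      by (intro subset_up_times_E E_square) (simp add: cosets_up C star_cosets)
    then have "star ` C * C \<subseteq> \<up>(star ` C * {star b * b} * C)"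
      by (rule times_subset_up) (simp add: cosets_up C)
    also have "\<dots> \<subseteq> \<up>(star ` C * (star ` B * B) * C)"
      using b by (intro up_mono set_times_mono2) auto
    finally show "source C \<subseteq> \<up>(star ` C * (star ` B * B) * C)"
      by (rule up_least)
  qed
  finally show ?thesis .
qed

lemma target_composite:
  assumes B: "B \<in> cosets" and C: "C \<in> cosets" and BC: "source B = target C"
  shows "target (\<up>(B * C)) = target B"
proof -
  have "source (\<up>(star ` C * star ` B)) = source (star ` B)"
    using BC by (intro source_composite star_cosets B C) (simp add: star_image_star)
  moreover have "\<up>(star ` C * star ` B) = star ` \<up>(B * C)"
    by (simp add: star_up star_image_times)
  ultimately show ?thesis
    by (simp add: star_image_star)
qed

lemma up_triple:
  assumes C: "C \<in> cosets"
  shows "\<up>(C * star ` C * C) = C"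
proof
  show "\<up>(C * star ` C * C) \<subseteq> C"
    using up_mono[OF cosets_triple[OF C]] by (simp add: cosets_up C)
  obtain c where c: "c \<in> C"
    using cosets_nonempty[OF C] by blast
  have "C \<subseteq> \<up>(C * {star c * c})"
    by (intro subset_up_times_E E_square) (simp add: cosets_up C)
  also have "\<dots> \<subseteq> \<up>(C * star ` C * C)"
    unfolding mult.assoc using c by (intro up_mono set_times_mono2) auto
  finally show "C \<subseteq> \<up>(C * star ` C * C)" .
qed

section \<open>The groupoid of cosets\<close>

abbreviation composable :: "('a set \<times> 'a set) set" where
  "composable \<equiv> composable_cosets E"

abbreviation comp :: "'a set \<Rightarrow> 'a set \<Rightarrow> 'a set" where
  "comp \<equiv> \<lambda>B C. \<up>(B * C)"

lemma composable_iff: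
  "(B, C) \<in> composable \<longleftrightarrow> B \<in> cosets \<and> C \<in> cosets \<and> source B = target C"
  by (simp add: composable_cosets_def)

lemma composable_star:
  assumes "C \<in> cosets"
  shows "(star ` C, C) \<in> composable" "(C, star ` C) \<in> composable"
  using assms star_cosets by (simp_all add: composable_iff star_image_star)

lemma comp_assoc:
  assumes B: "B \<in> cosets" and C: "C \<in> cosets" and D: "D \<in> cosets"
  shows "comp (comp B C) D = comp B (comp C D)"
proof -
  have "comp (comp B C) D = \<up>(B * C * D)"
    by (intro up_up_times composite_subset_up B C) (simp add: cosets_up D)
  also have "\<dots> = comp B (comp C D)"
    unfolding mult.assoc by (intro up_times_up[symmetric] composite_subset_up C D) (simp add: cosets_up B)
  finally show ?thesis .
qed

text \<open>The target of \<open>C\<close> is both source and target of itself, so a coset composable with it on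
  either side has this same coset as its own target or source, and \<open>up_triple\<close> applies.\<close>

lemma identity_target:
  assumes C: "C \<in> cosets"
  shows "identity_arrow cosets composable comp (target C)"
proof -
  have triv: "source C = target (star ` C)"
    by (simp add: star_image_star)
  have coset: "target C \<in> cosets"
    by (rule composite_cosets[OF C star_cosets[OF C] triv])
  have src: "source (target C) = target C"
    using source_composite[OF C star_cosets[OF C] triv] by (simp add: star_image_star)
  have tgt: "target (target C) = target C"
    by (rule target_composite[OF C star_cosets[OF C] triv])
  have "comp (target C) X = X" if "(target C, X) \<in> composable" for X
  proof -
    have X: "X \<in> cosets" and eq: "target C = target X"
      using that src by (simp_all add: composable_iff)
    have "comp (target X) X = \<up>(X * star ` X * X)"
      by (intro up_up_times composite_subset_up star_cosets X) (simp add: cosets_up X)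
    then show ?thesis
      using up_triple[OF X] eq by simp
  qed
  moreover have "comp X (target C) = X" if "(X, target C) \<in> composable" for X
  proof -
    have X: "X \<in> cosets" and eq: "target C = source X"
      using that tgt by (simp_all add: composable_iff)
    have "comp X (source X) = \<up>(X * star ` X * X)"
      unfolding mult.assoc by (intro up_times_up composite_subset_up star_cosets X) (simp add: cosets_up X)
    then show ?thesis
      using up_triple[OF X] eq by simp
  qed
  ultimately show ?thesis
    using coset by (simp add: identity_arrow_def)
qed

lemma identity_source:
  assumes "C \<in> cosets"
  shows "identity_arrow cosets composable comp (source C)"
  using identity_target[OF star_cosets[OF assms]] by (simp add: star_image_star)

lemma composable_target:
  assumes C: "C \<in> cosets"
  shows "(target C, C) \<in> composable"
  using composable_star(2)[OF C] composite_cosets[OF C star_cosets[OF C]]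
    source_composite[OF C star_cosets[OF C]] C
  by (simp add: composable_iff star_image_star)

lemma composable_source:
  assumes C: "C \<in> cosets"
  shows "(C, source C) \<in> composable"
  using composable_star(1)[OF C] composite_cosets[OF star_cosets[OF C] C]
    target_composite[OF star_cosets[OF C] C] C
  by (simp add: composable_iff star_image_star)

lemma small_category_cosets: "small_category cosets composable comp"
  unfolding small_category_def
proof (intro conjI ballI allI)
  show "composable \<subseteq> cosets \<times> cosets"
    by (auto simp: composable_iff)
  show "(B, C) \<in> composable \<longrightarrow> comp B C \<in> cosets" for B C
    using composite_cosets by (simp add: composable_iff)
next
  fix B C D assume BCD: "B \<in> cosets" "C \<in> cosets" "D \<in> cosets"
  have left: "(comp B C, D) \<in> composable \<longleftrightarrow> (C, D) \<in> composable" if "(B, C) \<in> composable"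
    using that BCD composite_cosets source_composite by (simp add: composable_iff)
  have right: "(B, comp C D) \<in> composable \<longleftrightarrow> (B, C) \<in> composable" if "(C, D) \<in> composable"
    using that BCD composite_cosets target_composite by (simp add: composable_iff)
  show "(B, C) \<in> composable \<and> (comp B C, D) \<in> composable \<longleftrightarrow>
      (C, D) \<in> composable \<and> (B, comp C D) \<in> composable"
    using left right by blast
  show "(B, C) \<in> composable \<and> (C, D) \<in> composable \<longrightarrow> (comp B C, D) \<in> composable"
    using left by blast
  show "(B, C) \<in> composable \<and> (comp B C, D) \<in> composable \<longrightarrow>
      comp (comp B C) D = comp B (comp C D)"
    using comp_assoc[OF BCD] by blast
next
  fix C assume "C \<in> cosets"
  then show "\<exists>u v. identity_arrow cosets composable comp u \<and>
      identity_arrow cosets composable comp v \<and> (u, C) \<in> composable \<and> (C, v) \<in> composable"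
    using identity_target identity_source composable_target composable_source by blast
qed

lemma groupoid_cosets: "groupoid cosets composable comp (\<lambda>C. star ` C)"
  unfolding groupoid_def
  using small_category_cosets star_cosets composable_star identity_source identity_target by blast

end

theorem theorem2p32:
  fixes E :: "'a::star_semigroup set"
  assumes "weyl_star_semigroup E"
  shows "groupoid (nonempty_cosets E) (composable_cosets E)
           (\<lambda>B C. up_closure E (B * C)) (\<lambda>C. star ` C) \<and>
         (\<forall>(B, C)\<in>composable_cosets E. \<forall>c\<in>C.
            up_closure E (B * C) = up_closure E (B * {c}))"
proof -
  interpret weyl_star E
    by unfold_locales (rule assms)
  show ?thesis
    using groupoid_cosets composite_single by (auto simp: composable_iff)
qed

end
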